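(* Assume ${\rm MA}(\sigma\text{-centered})$. Then there is a $\mathfrak c$-almost decided mad family on $T$.
   Context: $T={}^{\omega>}2$ and $\mathfrak c=2^{\aleph_0}$. Almost disjoint = finite intersection; a mad family on $T$ is a maximal pairwise almost disjoint family of infinite subsets of $T$ with union $T$. For a family $\mathcal B$ of subsets of $T$, $\mathcal B^\perp=\{Y\in[T]^{\aleph_0}:|X\cap Y|<\aleph_0\ \forall X\in\mathcal B\}$. For an almost disjoint family $\mathcal G$, $\mathcal I(\mathcal G)$ is the ideal on $T$ generated by $\mathcal G\cup[T]^{<\omega}$, i.e. $S\in\mathcal I(\mathcal G)$ iff $S\setminus\bigcup\mathcal G'$ is finite for some finite $\mathcal G'\subseteq\mathcal G$. For a mad family $\mathcal F$ and $\mathcal B\subseteq\mathcal F$, $\mathcal B$ almost decides $\mathcal F$ if $\mathcal B^\perp=\mathcal I(\mathcal F\setminus\mathcal B)$ (as families of infinite subsets of $T$). $\mathcal F$ is $\kappa$-almost decided if every $\mathcal B\in[\mathcal F]^\kappa$ almost decides $\mathcal F$. ${\rm MA}(\sigma\text{-centered})$ is Martin's Axiom for $\sigma$-centered posets (for fewer than $\mathfrak c$ dense sets). *)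

theory Defs
  imports "HOL-Library.Equipollence" "HOL-Library.Nat_Bijection"
begin

text \<open>
  The tree \<open>T\<close> of finite binary sequences is the type \<^typ>\<open>bool list\<close>, so that subsets of \<open>T\<close> have
  type \<^typ>\<open>bool list set\<close>. The continuum \<open>2\<^sup>\<aleph>\<^sup>0\<close> is represented by the set of all sets of naturals,
  and cardinal comparisons are the relations of \<^theory>\<open>HOL-Library.Equipollence\<close>.
\<close>

abbreviation continuum :: "nat set set" where
  "continuum \<equiv> UNIV"

section \<open>Almost decided mad families\<close>

definition almost_disjoint :: "'a set \<Rightarrow> 'a set \<Rightarrow> bool" where
  "almost_disjoint X Y \<longleftrightarrow> finite (X \<inter> Y)"

definition ad_family :: "bool list set set \<Rightarrow> bool" where
  "ad_family \<F> \<longleftrightarrow> (\<forall>X\<in>\<F>. infinite X) \<and> pairwise almost_disjoint \<F>"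

text \<open>
  Finite families such as \<open>{UNIV}\<close> satisfy the following definition. The usual convention that mad
  families are infinite has to be imposed separately.
\<close>

definition mad_family :: "bool list set set \<Rightarrow> bool" where
  "mad_family \<F> \<longleftrightarrow>
     ad_family \<F> \<and> (\<forall>\<G>. ad_family \<G> \<and> \<F> \<subseteq> \<G> \<longrightarrow> \<G> = \<F>) \<and> \<Union>\<F> = UNIV"

definition orthogonal :: "bool list set set \<Rightarrow> bool list set set" where
  "orthogonal \<B> = {Y. infinite Y \<and> (\<forall>X\<in>\<B>. almost_disjoint X Y)}"

definition generated_ideal :: "bool list set set \<Rightarrow> bool list set set" where
  "generated_ideal \<G> = {S. \<exists>\<G>'\<subseteq>\<G>. finite \<G>' \<and> finite (S - \<Union>\<G>')}"

text \<open>The orthogonal contains only infinite sets, so the ideal is restricted to its infinite members.\<close>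

definition almost_decides :: "bool list set set \<Rightarrow> bool list set set \<Rightarrow> bool" where
  "almost_decides \<B> \<F> \<longleftrightarrow> orthogonal \<B> = {S \<in> generated_ideal (\<F> - \<B>). infinite S}"

text \<open>The cardinal \<open>\<kappa>\<close> is given by any set \<open>K\<close> of that cardinality.\<close>

definition almost_decided :: "'k set \<Rightarrow> bool list set set \<Rightarrow> bool" where
  "almost_decided K \<F> \<longleftrightarrow> (\<forall>\<B>\<subseteq>\<F>. \<B> \<approx> K \<longrightarrow> almost_decides \<B> \<F>)"

section \<open>Martin's Axiom for sigma-centered posets\<close>

text \<open>
  A poset is a carrier \<open>P\<close> with a relation \<open>r\<close>; \<open>(p, q) \<in> r\<close> reads \<open>p \<le> q\<close>, that is, \<open>p\<close> is the
  stronger condition.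
\<close>

definition centered_in :: "'a set \<Rightarrow> 'a rel \<Rightarrow> 'a set \<Rightarrow> bool" where
  "centered_in P r C \<longleftrightarrow> (\<forall>F\<subseteq>C. finite F \<longrightarrow> (\<exists>q\<in>P. \<forall>x\<in>F. (q, x) \<in> r))"

definition sigma_centered :: "'a set \<Rightarrow> 'a rel \<Rightarrow> bool" where
  "sigma_centered P r \<longleftrightarrow> (\<exists>C :: nat \<Rightarrow> 'a set. P = (\<Union>n. C n) \<and> (\<forall>n. centered_in P r (C n)))"

definition dense_in :: "'a set \<Rightarrow> 'a rel \<Rightarrow> 'a set \<Rightarrow> bool" where
  "dense_in P r D \<longleftrightarrow> D \<subseteq> P \<and> (\<forall>p\<in>P. \<exists>d\<in>D. (d, p) \<in> r)"

definition filter_in :: "'a set \<Rightarrow> 'a rel \<Rightarrow> 'a set \<Rightarrow> bool" where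
  "filter_in P r G \<longleftrightarrow> G \<subseteq> P \<and> G \<noteq> {} \<and>
     (\<forall>p\<in>G. \<forall>q\<in>P. (p, q) \<in> r \<longrightarrow> q \<in> G) \<and>
     (\<forall>p\<in>G. \<forall>q\<in>G. \<exists>s\<in>G. (s, p) \<in> r \<and> (s, q) \<in> r)"

definition MA_sigma_centered_on :: "'a itself \<Rightarrow> bool" where
  "MA_sigma_centered_on _ \<longleftrightarrow>
     (\<forall>(P :: 'a set) r \<D>.
        P \<noteq> {} \<and> partial_order_on P r \<and> sigma_centered P r \<and>
        (\<forall>D\<in>\<D>. dense_in P r D) \<and> \<D> \<prec> continuum \<longrightarrow>
        (\<exists>G. filter_in P r G \<and> (\<forall>D\<in>\<D>. G \<inter> D \<noteq> {})))"

text \<open>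
  A formula cannot quantify over all types, so the axiom is stated for the posets whose carrier is a
  subset of the type \<^typ>\<open>nat set\<close>, that is, up to isomorphism, for those with at most continuum
  many elements. Nothing is lost: by the lemma \<open>MA_sigma_centered_any_type\<close> below, it implies the
  axiom for posets over every type.
\<close>

definition MA_sigma_centered :: bool where
  "MA_sigma_centered \<longleftrightarrow> MA_sigma_centered_on TYPE(nat set)"

lemma lists_lepoll_continuum:
  assumes "X \<lesssim> continuum"
  shows "lists X \<lesssim> continuum"
proof -
  define e :: "nat set list \<Rightarrow> nat set" where
    "e = (\<lambda>xs. {prod_encode (0, length xs)} \<union>
               {prod_encode (Suc i, k) | i k. i < length xs \<and> k \<in> xs ! i})"
  have len: "prod_encode (0, n) \<in> e xs \<longleftrightarrow> n = length xs" for n xs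
    by (auto simp: e_def)
  have nth: "prod_encode (Suc i, k) \<in> e xs \<longleftrightarrow> i < length xs \<and> k \<in> xs ! i" for i k xs
    by (auto simp: e_def)
  have "inj e"
  proof (rule injI)
    fix xs ys assume eq: "e xs = e ys"
    have l: "length xs = length ys"
      using len[of "length xs" xs] len[of "length xs" ys] eq by simp
    show "xs = ys"
    proof (rule nth_equalityI[OF l])
      fix i assume "i < length xs"
      then show "xs ! i = ys ! i"
        using nth[of i _ xs] nth[of i _ ys] eq l by auto
    qed
  qed
  then have "(UNIV :: nat set list set) \<lesssim> continuum"
    unfolding lepoll_def by blast
  then show ?thesis
    using lists_lepoll_mono[OF assms] lepoll_trans by (metis lists_UNIV)
qed

lemma infinite_continuum: "infinite continuum"
  by (simp add: Finite_Set.finite_set)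

lemma Un_lepoll_continuum:
  assumes "X \<lesssim> continuum" "Y \<lesssim> continuum"
  shows "X \<union> Y \<lesssim> continuum"
  using assms card_of_Un_ordLeq_infinite_Field[of "card_of continuum" X Y] infinite_continuum
  unfolding lepoll_def card_of_ordLeq Field_card_of by (simp add: card_of_card_order_on)

lemma Times_lepoll_continuum:
  assumes "X \<lesssim> continuum" "Y \<lesssim> continuum"
  shows "X \<times> Y \<lesssim> continuum"
  using assms card_of_Sigma_ordLeq_infinite[OF infinite_continuum, of X "\<lambda>_. Y"]
  unfolding lepoll_def card_of_ordLeq by simp

lemma UN_nat_lepoll_continuum:
  fixes X :: "nat \<Rightarrow> 'a set"
  assumes "\<And>n. X n \<lesssim> continuum"
  shows "(\<Union>n. X n) \<lesssim> continuum"
proof -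
  have "inj (\<lambda>n :: nat. {n})"
    by (rule injI) simp
  then have "(UNIV :: nat set) \<lesssim> continuum"
    unfolding lepoll_def by blast
  then show ?thesis
    using assms card_of_UNION_ordLeq_infinite[OF infinite_continuum, of "UNIV :: nat set" X]
    unfolding lepoll_def card_of_ordLeq by simp
qed

text \<open>A Loewenheim-Skolem argument: pass to a small subposet closed under the relevant witnesses.\<close>

lemma small_subposet:
  fixes P :: "'a set"
  assumes "P \<noteq> {}" and dense: "\<And>D. D \<in> \<D> \<Longrightarrow> dense_in P r D" and "\<D> \<lesssim> continuum"
  obtains Q where "Q \<subseteq> P" "Q \<noteq> {}" "Q \<lesssim> continuum"
    "\<And>D p. D \<in> \<D> \<Longrightarrow> p \<in> Q \<Longrightarrow> \<exists>d\<in>D \<inter> Q. (d, p) \<in> r"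
    "\<And>F p. finite F \<Longrightarrow> F \<subseteq> Q \<Longrightarrow> p \<in> P \<Longrightarrow> (\<forall>x\<in>F. (p, x) \<in> r) \<Longrightarrow> \<exists>q\<in>Q. \<forall>x\<in>F. (q, x) \<in> r"
proof -
  obtain p0 where p0: "p0 \<in> P"
    using assms(1) by blast
  define f where "f = (\<lambda>D p. SOME d. d \<in> D \<and> (d, p) \<in> r)"
  define g where "g = (\<lambda>xs. SOME q. q \<in> P \<and> (\<forall>x\<in>set xs. (q, x) \<in> r))"
  define B where "B = {xs. \<exists>q\<in>P. \<forall>x\<in>set xs. (q, x) \<in> r}"
  define step where "step = (\<lambda>X. X \<union> ((\<lambda>(D, p). f D p) ` (\<D> \<times> X) \<union> g ` (lists X \<inter> B)))"
  define Qn where "Qn = (\<lambda>n. (step ^^ n) {p0})"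
  have Qn0: "Qn 0 = {p0}" and QnS: "Qn (Suc n) = step (Qn n)" for n
    by (simp_all add: Qn_def)
  have f: "f D p \<in> D \<and> (f D p, p) \<in> r" if "D \<in> \<D>" "p \<in> P" for D p
    unfolding f_def by (rule someI_ex) (use dense[OF that(1)] that in \<open>auto simp: dense_in_def\<close>)
  have g: "g xs \<in> P \<and> (\<forall>x\<in>set xs. (g xs, x) \<in> r)" if "xs \<in> B" for xs
    unfolding g_def by (rule someI_ex) (use that in \<open>auto simp: B_def\<close>)
  have sub: "Qn n \<subseteq> P" for n
  proof (induction n)
    case (Suc n)
    have "f D p \<in> P" if "D \<in> \<D>" "p \<in> Qn n" for D p
      using f[of D p] dense[of D] that Suc by (auto simp: dense_in_def)
    then show ?case
      using Suc g by (auto simp: QnS step_def)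
  qed (use p0 in \<open>simp add: Qn0\<close>)
  have small: "Qn n \<lesssim> continuum" for n
  proof (induction n)
    case 0
    have "inj_on (\<lambda>_. {}) {p0}" by simp
    then show ?case
      unfolding Qn0 lepoll_def by blast
  next
    case (Suc n)
    have "(\<lambda>(D, p). f D p) ` (\<D> \<times> Qn n) \<lesssim> continuum"
      using image_lepoll Times_lepoll_continuum[OF assms(3) Suc] lepoll_trans by blast
    moreover have "lists (Qn n) \<inter> B \<lesssim> continuum"
      using lists_lepoll_continuum[OF Suc] subset_imp_lepoll[of "lists (Qn n) \<inter> B" "lists (Qn n)"]
        lepoll_trans by blast
    then have "g ` (lists (Qn n) \<inter> B) \<lesssim> continuum"
      using image_lepoll lepoll_trans by blast
    ultimately show ?case
      unfolding QnS step_def by (intro Un_lepoll_continuum Suc)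
  qed
  have "Qn n \<subseteq> Qn (Suc n)" for n
    by (auto simp: QnS step_def)
  then have mono: "Qn m \<subseteq> Qn n" if "m \<le> n" for m n
    using that by (rule lift_Suc_mono_le)
  define Q where "Q = (\<Union>n. Qn n)"
  show thesis
  proof (rule that[of Q])
    show "Q \<subseteq> P" "Q \<lesssim> continuum"
      using sub small by (auto simp: Q_def intro: UN_nat_lepoll_continuum)
    show "Q \<noteq> {}"
      using Qn0 by (auto simp: Q_def)
    show "\<exists>d\<in>D \<inter> Q. (d, p) \<in> r" if D: "D \<in> \<D>" and p: "p \<in> Q" for D p
    proof -
      obtain n where n: "p \<in> Qn n"
        using p by (auto simp: Q_def)
      then have "f D p \<in> Qn (Suc n)"
        using D by (auto simp: QnS step_def)
      moreover have "f D p \<in> D" "(f D p, p) \<in> r"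
        using f[OF D, of p] n sub by auto
      ultimately show ?thesis
        by (auto simp: Q_def)
    qed
    show "\<exists>q\<in>Q. \<forall>x\<in>F. (q, x) \<in> r"
      if F: "finite F" "F \<subseteq> Q" and p: "p \<in> P" "\<forall>x\<in>F. (p, x) \<in> r" for F p
    proof -
      have "\<exists>n. F \<subseteq> Qn n"
        using F
      proof (induction F)
        case (insert x F)
        then obtain m n where "F \<subseteq> Qn m" "x \<in> Qn n"
          by (auto simp: Q_def)
        then have "insert x F \<subseteq> Qn (max m n)"
          using mono[of m "max m n"] mono[of n "max m n"] by auto
        then show ?case ..
      qed auto
      then obtain n where n: "F \<subseteq> Qn n" ..
      obtain xs where xs: "set xs = F"
        using F finite_list by blast
      have "xs \<in> B"
        using xs p by (auto simp: B_def)
      moreover have "xs \<in> lists (Qn n)"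
        using xs n by auto
      ultimately have "g xs \<in> Qn (Suc n)"
        by (auto simp: QnS step_def)
      then show ?thesis
        using g[OF \<open>xs \<in> B\<close>] xs by (auto simp: Q_def)
    qed
  qed
qed

lemma MA_sigma_centered_any_type:
  assumes MA_sigma_centered
  shows "MA_sigma_centered_on TYPE('a)"
  unfolding MA_sigma_centered_on_def
proof (intro allI impI, elim conjE)
  fix P :: "'a set" and r \<D>
  assume P: "P \<noteq> {}" "partial_order_on P r" "sigma_centered P r"
    and dense: "\<forall>D\<in>\<D>. dense_in P r D" and lt: "\<D> \<prec> continuum"
  have "\<D> \<lesssim> continuum"
    using lt by (rule lesspoll_imp_lepoll)
  obtain Q where Q: "Q \<subseteq> P" "Q \<noteq> {}" "Q \<lesssim> continuum"
    and QD: "\<And>D p. D \<in> \<D> \<Longrightarrow> p \<in> Q \<Longrightarrow> \<exists>d\<in>D \<inter> Q. (d, p) \<in> r"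
    and QF: "\<And>F p. finite F \<Longrightarrow> F \<subseteq> Q \<Longrightarrow> p \<in> P \<Longrightarrow> (\<forall>x\<in>F. (p, x) \<in> r) \<Longrightarrow>
                \<exists>q\<in>Q. \<forall>x\<in>F. (q, x) \<in> r"
    by (rule small_subposet[OF P(1) bspec[OF dense] \<open>\<D> \<lesssim> continuum\<close>]) (assumption, rule that)
  obtain h :: "'a \<Rightarrow> nat set" where h: "inj_on h Q"
    using Q(3) by (auto simp: lepoll_def)
  have hI: "h x = h y \<longleftrightarrow> x = y" if "x \<in> Q" "y \<in> Q" for x y
    using h that by (auto simp: inj_on_def)
  define r' where "r' = {(h x, h y) | x y. x \<in> Q \<and> y \<in> Q \<and> (x, y) \<in> r}"
  have r': "(h x, h y) \<in> r' \<longleftrightarrow> (x, y) \<in> r" if "x \<in> Q" "y \<in> Q" for x y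
    using that by (auto simp: r'_def dest!: inj_onD[OF h])
  note po = partial_order_onD[OF P(2)]
  have "partial_order_on (h ` Q) r'"
    unfolding partial_order_on_def preorder_on_def
  proof (intro conjI)
    show "r' \<subseteq> h ` Q \<times> h ` Q"
      by (auto simp: r'_def)
    show "refl_on (h ` Q) r'"
      using po(1) Q(1) r' by (auto simp: refl_on_def)
    show "trans r'"
    proof (rule transI)
      fix a b c assume "(a, b) \<in> r'" "(b, c) \<in> r'"
      then obtain x y y' z where *: "a = h x" "b = h y" "b = h y'" "c = h z"
          "x \<in> Q" "y \<in> Q" "y' \<in> Q" "z \<in> Q" "(x, y) \<in> r" "(y', z) \<in> r"
        by (auto simp: r'_def)
      then have "(x, z) \<in> r"
        using hI[of y y'] transD[OF po(2), of x y z] by simp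
      then show "(a, c) \<in> r'"
        using * r'[of x z] by simp
    qed
    show "antisym r'"
      unfolding r'_def by (rule antisymI) (use hI in \<open>auto dest: antisymD[OF po(3)]\<close>)
  qed
  moreover have "sigma_centered (h ` Q) r'"
  proof -
    obtain C :: "nat \<Rightarrow> 'a set" where C: "P = (\<Union>n. C n)" "\<And>n. centered_in P r (C n)"
      using P(3) by (auto simp: sigma_centered_def)
    have "Q = (\<Union>n. C n \<inter> Q)"
      using Q(1) C(1) by auto
    then have "h ` Q = (\<Union>n. h ` (C n \<inter> Q))"
      by (metis image_UN)
    moreover have "centered_in (h ` Q) r' (h ` (C n \<inter> Q))" for n
      unfolding centered_in_def
    proof (intro allI impI)
      fix F assume "F \<subseteq> h ` (C n \<inter> Q)" "finite F"
      then obtain E where E: "E \<subseteq> C n \<inter> Q" "finite E" "F = h ` E"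
        by (meson finite_subset_image)
      obtain p where "p \<in> P" "\<forall>x\<in>E. (p, x) \<in> r"
        using C(2)[of n] E unfolding centered_in_def by (meson le_inf_iff)
      then obtain q where q: "q \<in> Q" "\<forall>x\<in>E. (q, x) \<in> r"
        using QF[of E p] E by auto
      then have "(h q, h x) \<in> r'" if "x \<in> E" for x
        using r'[of q x] E(1) that by auto
      then show "\<exists>q\<in>h ` Q. \<forall>x\<in>F. (q, x) \<in> r'"
        using E(3) q(1) by auto
    qed
    ultimately show ?thesis
      unfolding sigma_centered_def by blast
  qed
  moreover have "\<forall>D\<in>(\<lambda>D. h ` (D \<inter> Q)) ` \<D>. dense_in (h ` Q) r' D"
    unfolding dense_in_def
  proof (intro ballI conjI)
    fix D' p' assume "D' \<in> (\<lambda>D. h ` (D \<inter> Q)) ` \<D>"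
    then obtain D where D: "D \<in> \<D>" "D' = h ` (D \<inter> Q)"
      by blast
    then show "D' \<subseteq> h ` Q"
      by blast
    assume "p' \<in> h ` Q"
    then obtain p where p: "p \<in> Q" "p' = h p"
      by blast
    obtain d where "d \<in> D \<inter> Q" "(d, p) \<in> r"
      using QD[OF D(1) p(1)] by blast
    then show "\<exists>d\<in>D'. (d, p') \<in> r'"
      using r'[of d p] D(2) p by auto
  qed
  moreover have "(\<lambda>D. h ` (D \<inter> Q)) ` \<D> \<prec> continuum"
    using lt image_lepoll lesspoll_trans1 by blast
  moreover have "h ` Q \<noteq> {}"
    using Q(2) by simp
  ultimately obtain G where G: "filter_in (h ` Q) r' G"
    and GD: "\<forall>D\<in>(\<lambda>D. h ` (D \<inter> Q)) ` \<D>. G \<inter> D \<noteq> {}"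
    using assms[unfolded MA_sigma_centered_def MA_sigma_centered_on_def, rule_format,
        of "h ` Q" r' "(\<lambda>D. h ` (D \<inter> Q)) ` \<D>"] by blast
  have GQ: "G \<subseteq> h ` Q"
    using G by (simp add: filter_in_def)
  define H where "H = {p \<in> P. \<exists>q\<in>Q. h q \<in> G \<and> (q, p) \<in> r}"
  have inH: "q \<in> H" if "q \<in> Q" "h q \<in> G" for q
    using that Q(1) po(1) by (auto simp: H_def refl_on_def)
  have "filter_in P r H"
    unfolding filter_in_def
  proof (intro conjI ballI impI)
    show "H \<subseteq> P"
      by (auto simp: H_def)
    obtain y where "y \<in> G"
      using G by (auto simp: filter_in_def)
    then obtain q where "q \<in> Q" "h q \<in> G"
      using GQ by blast
    then show "H \<noteq> {}"
      using inH by auto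
  next
    fix p q assume "p \<in> H" "q \<in> P" "(p, q) \<in> r"
    then show "q \<in> H"
      using po(2) unfolding H_def trans_def by blast
  next
    fix p q assume "p \<in> H" "q \<in> H"
    then obtain x y where x: "x \<in> Q" "h x \<in> G" "(x, p) \<in> r" and y: "y \<in> Q" "h y \<in> G" "(y, q) \<in> r"
      by (auto simp: H_def)
    then obtain t where t: "t \<in> G" "(t, h x) \<in> r'" "(t, h y) \<in> r'"
      using G unfolding filter_in_def by meson
    then obtain s where s: "s \<in> Q" "h s \<in> G" "t = h s"
      using GQ by blast
    then have "(s, x) \<in> r" "(s, y) \<in> r"
      using t r' x y by auto
    then have "(s, p) \<in> r" "(s, q) \<in> r"
      using x y po(2) unfolding trans_def by blast+
    then show "\<exists>s\<in>H. (s, p) \<in> r \<and> (s, q) \<in> r"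
      using inH s by blast
  qed
  moreover have "\<forall>D\<in>\<D>. H \<inter> D \<noteq> {}"
    using GD inH by fastforce
  ultimately show "\<exists>G. filter_in P r G \<and> (\<forall>D\<in>\<D>. G \<inter> D \<noteq> {})"
    by blast
qed

end

theory Submission
  imports Defs "HOL-Library.Countable"
begin

text \<open>
  Enumerate all subsets of \<open>T\<close> as \<open>Y\<^sub>\<alpha>\<close> for \<open>\<alpha> < \<cc>\<close>. Starting from an infinite partition of \<open>T\<close> into
  infinite sets, add at each stage \<open>\<alpha>\<close> a set \<open>X\<^sub>\<alpha>\<close> that is almost disjoint from all earlier ones and
  meets in an infinite set every \<open>Y\<^sub>\<beta>\<close> with \<open>\<beta> \<le> \<alpha>\<close> outside the ideal generated so far. The
  \<open>\<sigma>\<close>-centered forcing of finite approximations with finitely many promises of disjointness yields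
  \<open>X\<^sub>\<alpha>\<close>. In the end every set outside the ideal generated by the family is almost disjoint from fewer
  than \<open>\<cc>\<close> of its members, which gives both maximality and \<open>\<cc>\<close>-almost decidedness.
\<close>

section \<open>Sets of size less than the continuum\<close>

text \<open>Comparability of cardinals turns strict domination into the failure of the converse
  injection. The lemma opens the arithmetic of infinite cardinals, stated for \<open><o\<close>, to
  the relation \<open>\<prec>\<close>.\<close>

lemma lesspoll_iff_card_of_ordLess:
  includes cardinal_syntax
  shows "A \<prec> B \<longleftrightarrow> |A| <o |B|"
proof -
  have "A \<prec> B \<longleftrightarrow> \<not> B \<lesssim> A"
  proof
    assume "A \<prec> B"
    then show "\<not> B \<lesssim> A"
      using lesspoll_not_refl lesspoll_trans1 by blast
  next
    assume *: "\<not> B \<lesssim> A"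
    then have "|A| <o |B|"
      unfolding lepoll_def card_of_ordLess .
    then have "A \<lesssim> B"
      unfolding lepoll_def card_of_ordLeq by (rule ordLess_imp_ordLeq)
    with * show "A \<prec> B"
      unfolding lesspoll_def using eqpoll_imp_lepoll eqpoll_sym by blast
  qed
  then show ?thesis
    unfolding lepoll_def card_of_ordLess .
qed

lemma finite_lesspoll_continuum: "finite A \<Longrightarrow> A \<prec> continuum"
  by (rule finite_lesspoll_infinite[OF infinite_continuum])

lemma nat_lesspoll_continuum: "(UNIV :: nat set) \<prec> continuum"
  using lesspoll_Pow_self[of "UNIV :: nat set"] by simp

lemma Un_lesspoll_continuum:
  assumes "A \<prec> continuum" "B \<prec> continuum"
  shows "A \<union> B \<prec> continuum"
  using assms card_of_Un_ordLess_infinite[OF infinite_continuum]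
  unfolding lesspoll_iff_card_of_ordLess by blast

lemma Times_nat_lesspoll_continuum:
  assumes "A \<prec> continuum"
  shows "A \<times> (UNIV :: nat set) \<prec> continuum"
proof -
  \<comment> \<open>The sum \<open>?B\<close> is infinite and dominates both factors, hence also
    their product; finite and infinite \<open>A\<close> need not be treated apart.\<close>
  let ?B = "A <+> (UNIV :: nat set)"
  have "?B \<prec> continuum"
    using assms nat_lesspoll_continuum card_of_Plus_ordLess_infinite[OF infinite_continuum]
    unfolding lesspoll_iff_card_of_ordLess by blast
  moreover have "A \<times> (UNIV :: nat set) \<lesssim> ?B"
    using card_of_Sigma_ordLeq_infinite[of ?B A "\<lambda>_. UNIV :: nat set"]
      card_of_Plus1[of A "UNIV :: nat set"] card_of_Plus2[of "UNIV :: nat set" A]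
    unfolding lepoll_def card_of_ordLeq by simp
  ultimately show ?thesis
    using lesspoll_trans1 by blast
qed

text \<open>A cardinal order has minimal order type, so its proper initial segments are smaller than
  the whole. Its strict part serves as the index order of the recursion.\<close>

lemma continuum_well_order:
  obtains R :: "nat set rel"
  where "wf R" "total R" "\<And>a. {b. (b, a) \<in> R} \<prec> continuum"
proof -
  let ?r = "card_of continuum"
  have wo: "Well_order ?r" and field: "Field ?r = UNIV"
    by (rule card_of_Well_order, rule Field_card_of)
  show thesis
  proof (rule that[of "?r - Id"])
    show "wf (?r - Id)"
      using wo by (simp add: well_order_on_def)
    show "total (?r - Id)"
      using wo field by (auto simp: well_order_on_def linear_order_on_def total_on_def)
    show "{b. (b, a) \<in> ?r - Id} \<prec> continuum" for a
    proof -
      have "{b. (b, a) \<in> ?r - Id} = underS ?r a"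
        by (auto simp: underS_def)
      then show ?thesis
        using card_of_underS[OF card_of_Card_order, of a continuum] field
        by (simp add: lesspoll_iff_card_of_ordLess)
    qed
  qed
qed

section \<open>One step of the construction\<close>

lemma ad_family_finite_Int:
  "ad_family \<F> \<Longrightarrow> X \<in> \<F> \<Longrightarrow> Y \<in> \<F> \<Longrightarrow> X \<noteq> Y \<Longrightarrow> finite (X \<inter> Y)"
  by (simp add: ad_family_def pairwise_def almost_disjoint_def)

lemma generated_ideal_mono: "\<G> \<subseteq> \<H> \<Longrightarrow> generated_ideal \<G> \<subseteq> generated_ideal \<H>"
  unfolding generated_ideal_def by blast

text \<open>Finitely many members of \<open>\<G>\<close> together cover only a finite part of
  \<open>Y\<close>.\<close>

lemma notin_generated_ideal_if_orthogonal:
  assumes "infinite Y" "\<And>X. X \<in> \<G> \<Longrightarrow> finite (X \<inter> Y)"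
  shows "Y \<notin> generated_ideal \<G>"
proof
  assume "Y \<in> generated_ideal \<G>"
  then obtain \<G>' where \<G>': "\<G>' \<subseteq> \<G>" "finite \<G>'" "finite (Y - \<Union>\<G>')"
    by (auto simp: generated_ideal_def)
  have "finite (\<Union>X\<in>\<G>'. X \<inter> Y)"
    using \<G>' assms(2) by blast
  then have "finite ((Y - \<Union>\<G>') \<union> (\<Union>X\<in>\<G>'. X \<inter> Y))"
    using \<G>'(3) by simp
  moreover have "Y \<subseteq> (Y - \<Union>\<G>') \<union> (\<Union>X\<in>\<G>'. X \<inter> Y)"
    by blast
  ultimately show False
    using assms(1) finite_subset by blast
qed

text \<open>A member outside a given finite subfamily is almost disjoint from each set in it, so an
  infinite part of that member stays uncovered.\<close>

lemma UNIV_notin_generated_ideal: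
  assumes "ad_family \<G>" "infinite \<G>"
  shows "UNIV \<notin> generated_ideal \<G>"
proof
  assume "UNIV \<in> generated_ideal \<G>"
  then obtain \<G>' where \<G>': "\<G>' \<subseteq> \<G>" "finite \<G>'" "finite (UNIV - \<Union>\<G>')"
    by (auto simp: generated_ideal_def)
  obtain Z where Z: "Z \<in> \<G>" "Z \<notin> \<G>'"
    using assms(2) \<G>'(1,2) by (metis finite_subset subsetI)
  have "finite (X \<inter> Z)" if "X \<in> \<G>'" for X
    using that Z \<G>'(1) by (intro ad_family_finite_Int[OF assms(1)]) auto
  then have "Z \<notin> generated_ideal \<G>'"
    using assms(1) Z(1)
    by (intro notin_generated_ideal_if_orthogonal) (simp_all add: ad_family_def)
  moreover have "finite (Z - \<Union>\<G>')"
    using \<G>'(3) by (rule finite_subset[rotated]) blast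
  ultimately show False
    using \<G>'(2) by (auto simp: generated_ideal_def)
qed

lemma MA_almost_disjoint_extension:
  fixes \<G> \<Y> :: "bool list set set"
  assumes MA: MA_sigma_centered
    and \<G>: "\<G> \<prec> continuum" and \<Y>: "\<Y> \<prec> continuum"
    and pos: "\<And>Y. Y \<in> \<Y> \<Longrightarrow> Y \<notin> generated_ideal \<G>"
  obtains X where "\<And>Z. Z \<in> \<G> \<Longrightarrow> finite (X \<inter> Z)" "\<And>Y. Y \<in> \<Y> \<Longrightarrow> infinite (X \<inter> Y)"
proof -
  \<comment> \<open>A condition \<open>(s, H)\<close> promises that \<open>X\<close> contains \<open>s\<close> and that \<open>X - s\<close> misses \<open>\<Union>H\<close>.\<close>
  define P where "P = {(s :: bool list set, H). finite s \<and> finite H \<and> H \<subseteq> \<G>}"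
  define r where "r = {((s', H'), (s, H)) | s' H' s H. (s', H') \<in> P \<and> (s, H) \<in> P \<and>
    s \<subseteq> s' \<and> H \<subseteq> H' \<and> (s' - s) \<inter> \<Union>H = {}}"
  \<comment> \<open>Meeting \<open>D Z\<close> makes the generic set almost disjoint from
    \<open>Z\<close>; meeting \<open>E (Y, n)\<close> puts at least \<open>n\<close> points of
    \<open>Y\<close> into it.\<close>
  define D where "D = (\<lambda>Z. {(s, H). (s, H) \<in> P \<and> Z \<in> H})"
  define E where "E = (\<lambda>(Y, n). {(s, H). (s, H) \<in> P \<and> n \<le> card (s \<inter> Y)})"
  have ne: "P \<noteq> {}"
    by (auto simp: P_def)
  have po: "partial_order_on P r"
    unfolding partial_order_on_def preorder_on_def
  proof (intro conjI)
    show "r \<subseteq> P \<times> P"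
      by (auto simp: r_def)
    show "refl_on P r"
      by (auto simp: r_def refl_on_def)
    show "trans r"
    proof (rule transI)
      fix x y z assume "(x, y) \<in> r" "(y, z) \<in> r"
      then obtain s1 H1 s2 H2 s3 H3 where *: "x = (s1, H1)" "y = (s2, H2)" "z = (s3, H3)"
          "(s1, H1) \<in> P" "(s3, H3) \<in> P" "s3 \<subseteq> s2" "s2 \<subseteq> s1" "H3 \<subseteq> H2" "H2 \<subseteq> H1"
          "(s2 - s3) \<inter> \<Union>H3 = {}" "(s1 - s2) \<inter> \<Union>H2 = {}"
        unfolding r_def by blast
      have "\<Union>H3 \<subseteq> \<Union>H2"
        using *(8) by (rule Union_mono)
      then have "(s1 - s3) \<inter> \<Union>H3 = {}"
        using *(10,11) by blast
      moreover have "s3 \<subseteq> s1" "H3 \<subseteq> H1"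
        using * by simp_all
      ultimately show "(x, z) \<in> r"
        using *(1-5) by (simp add: r_def)
    qed
    show "antisym r"
      by (rule antisymI) (auto simp: r_def)
  qed
  have sc: "sigma_centered P r"
    unfolding sigma_centered_def
  proof (intro exI conjI allI)
    \<comment> \<open>Conditions with the same finite part are compatible: uniting their promises
      adds no points. There are only countably many finite parts, since \<open>T\<close> is
      countable.\<close>
    let ?C = "\<lambda>n. {(s, H). (s, H) \<in> P \<and> s = set (from_nat n :: bool list list)}"
    have "\<exists>n. s = set (from_nat n :: bool list list)" if s: "finite s" for s
    proof -
      obtain xs where "set xs = s"
        using finite_list[OF s] by blast
      then have "s = set (from_nat (to_nat xs))"
        by simp
      then show ?thesis
        by blast
    qed
    then show "P = (\<Union>n. ?C n)"
      by (auto simp: P_def)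
    show "centered_in P r (?C n)" for n
      unfolding centered_in_def
    proof (intro allI impI)
      fix F assume F: "F \<subseteq> ?C n" "finite F"
      let ?q = "(set (from_nat n :: bool list list), \<Union>(snd ` F))"
      have F': "x \<in> P" "x = (set (from_nat n), snd x)" if "x \<in> F" for x
        using F(1) that by auto
      have "finite (snd x)" "snd x \<subseteq> \<G>" if "x \<in> F" for x
        using F'(1)[OF that] by (auto simp: P_def)
      then have q: "?q \<in> P"
        using F(2) by (simp add: P_def UN_subset_iff)
      have "(?q, x) \<in> r" if x: "x \<in> F" for x
      proof -
        obtain H where H: "x = (set (from_nat n), H)"
          using F'(2)[OF x] by blast
        moreover have "H \<subseteq> \<Union>(snd ` F)"
          using x H by force
        ultimately show ?thesis
          using q F'(1)[OF x] by (simp add: r_def)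
      qed
      with q show "\<exists>q\<in>P. \<forall>x\<in>F. (q, x) \<in> r"
        by blast
    qed
  qed
  have denseD: "dense_in P r (D Z)" if "Z \<in> \<G>" for Z
  proof -
    have "((s, insert Z H), (s, H)) \<in> r \<and> (s, insert Z H) \<in> D Z" if "(s, H) \<in> P" for s H
      using that \<open>Z \<in> \<G>\<close> by (auto simp: r_def P_def D_def)
    then show ?thesis
      unfolding dense_in_def by (force simp: D_def)
  qed
  have denseE: "dense_in P r (E (Y, n))" if "Y \<in> \<Y>" for Y n
  proof -
    have "\<exists>s'. ((s', H), (s, H)) \<in> r \<and> (s', H) \<in> E (Y, n)" if p: "(s, H) \<in> P" for s H
    proof -
      \<comment> \<open>Positivity of \<open>Y\<close> enters here: the finitely many promised sets
        leave infinitely many points of \<open>Y\<close> free to be added.\<close>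
      have "infinite (Y - \<Union>H)"
        using pos[OF \<open>Y \<in> \<Y>\<close>] p by (auto simp: P_def generated_ideal_def)
      then obtain t where t: "finite t" "card t = n" "t \<subseteq> Y - \<Union>H"
        using infinite_arbitrarily_large by blast
      have "n \<le> card ((s \<union> t) \<inter> Y)"
        unfolding t(2)[symmetric] by (rule card_mono) (use t p in \<open>auto simp: P_def\<close>)
      then have "((s \<union> t, H), (s, H)) \<in> r \<and> (s \<union> t, H) \<in> E (Y, n)"
        using p t by (auto simp: r_def P_def E_def)
      then show ?thesis ..
    qed
    then show ?thesis
      unfolding dense_in_def by (force simp: E_def)
  qed
  have dense: "\<forall>A\<in>D ` \<G> \<union> E ` (\<Y> \<times> UNIV). dense_in P r A"
    using denseD denseE by auto
  have less: "D ` \<G> \<union> E ` (\<Y> \<times> UNIV) \<prec> continuum"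
    by (intro Un_lesspoll_continuum lesspoll_trans1[OF image_lepoll]
        Times_nat_lesspoll_continuum \<G> \<Y>)
  obtain G where G: "filter_in P r G"
    and GDE: "\<forall>A\<in>D ` \<G> \<union> E ` (\<Y> \<times> UNIV). G \<inter> A \<noteq> {}"
    using MA_sigma_centered_any_type[OF MA, unfolded MA_sigma_centered_on_def, rule_format,
        OF conjI[OF ne conjI[OF po conjI[OF sc conjI[OF dense less]]]]] by blast
  have GD: "G \<inter> D Z \<noteq> {}" if "Z \<in> \<G>" for Z
    using GDE that by blast
  have GE: "G \<inter> E (Y, n) \<noteq> {}" if "Y \<in> \<Y>" for Y n
    using GDE that by blast
  define X where "X = (\<Union>(s, H)\<in>G. s)"
  show thesis
  proof (rule that[of X])
    fix Z assume "Z \<in> \<G>"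
    then obtain s H where sH: "(s, H) \<in> G" "Z \<in> H" "finite s"
      using GD[of Z] by (auto simp: D_def P_def)
    \<comment> \<open>In a common extension of \<open>(s, H)\<close> and any other condition of the
      filter, the promise \<open>Z \<in> H\<close> keeps all points added to \<open>s\<close> out of
      \<open>Z\<close>.\<close>
    have "X \<inter> Z \<subseteq> s"
    proof
      fix x assume x: "x \<in> X \<inter> Z"
      then obtain s1 H1 where 1: "(s1, H1) \<in> G" "x \<in> s1"
        by (auto simp: X_def)
      then obtain s2 H2 where "((s2, H2), (s, H)) \<in> r" "((s2, H2), (s1, H1)) \<in> r"
        using G sH(1) unfolding filter_in_def by fast
      then show "x \<in> s"
        using 1 x sH(2) by (auto simp: r_def)
    qed
    then show "finite (X \<inter> Z)"
      using sH(3) finite_subset by blast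
  next
    fix Y assume Y: "Y \<in> \<Y>"
    show "infinite (X \<inter> Y)"
    proof
      assume fin: "finite (X \<inter> Y)"
      obtain s H where sH: "(s, H) \<in> G" "Suc (card (X \<inter> Y)) \<le> card (s \<inter> Y)"
        using GE[OF Y, of "Suc (card (X \<inter> Y))"] by (auto simp: E_def)
      have "card (s \<inter> Y) \<le> card (X \<inter> Y)"
        by (rule card_mono[OF fin]) (use sH(1) in \<open>auto simp: X_def\<close>)
      with sH(2) show False
        by simp
    qed
  qed
qed

section \<open>The mad family\<close>

lemma countable_infinite_partition:
  obtains B :: "nat \<Rightarrow> bool list set"
  where "\<And>n. infinite (B n)" "\<And>m n. m \<noteq> n \<Longrightarrow> B m \<inter> B n = {}" "(\<Union>n. B n) = UNIV"
\<comment> \<open>Sequences are sorted by the number of leading \<open>True\<close> entries; after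
  the first \<open>False\<close> the continuation is arbitrary, so each class is infinite.\<close>
proof (rule that[of "\<lambda>n. {xs. length (takeWhile id xs) = n}"])
  show "infinite {xs. length (takeWhile id xs) = n}" for n
  proof -
    have "(\<lambda>ys. replicate n True @ False # ys) ` UNIV \<subseteq> {xs. length (takeWhile id xs) = n}"
      by (auto simp: takeWhile_append)
    moreover have "infinite ((\<lambda>ys. replicate n True @ False # ys) ` UNIV)"
      by (subst finite_image_iff) (auto simp: inj_on_def infinite_UNIV_listI)
    ultimately show ?thesis
      using finite_subset by blast
  qed
qed auto

text \<open>A set outside the ideal is orthogonal to too few members: neither to all of
  \<open>\<F>\<close>, as a new member of a larger family would be, nor to a subfamily of size
  \<open>K\<close>.\<close>

lemma mad_family_almost_decided_if_orthogonal_small: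
  assumes ad: "ad_family \<F>" and cover: "\<Union>\<F> = UNIV" and big: "\<not> \<F> \<prec> K"
    and small: "\<And>Y. Y \<notin> generated_ideal \<F> \<Longrightarrow> {X \<in> \<F>. finite (X \<inter> Y)} \<prec> K"
  shows "mad_family \<F> \<and> almost_decided K \<F>"
proof
  have "\<G> = \<F>" if \<G>: "ad_family \<G>" "\<F> \<subseteq> \<G>" for \<G>
  proof (rule ccontr)
    assume "\<G> \<noteq> \<F>"
    then obtain Y where Y: "Y \<in> \<G>" "Y \<notin> \<F>"
      using \<G>(2) by blast
    have fin: "finite (X \<inter> Y)" if "X \<in> \<F>" for X
      using that Y \<G>(2) by (intro ad_family_finite_Int[OF \<G>(1)]) auto
    then have "Y \<notin> generated_ideal \<F>"
      using \<G>(1) Y(1) by (intro notin_generated_ideal_if_orthogonal) (simp_all add: ad_family_def)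
    moreover have "{X \<in> \<F>. finite (X \<inter> Y)} = \<F>"
      using fin by blast
    ultimately show False
      using small[of Y] big by simp
  qed
  then show "mad_family \<F>"
    using ad cover by (simp add: mad_family_def)
  show "almost_decided K \<F>"
    unfolding almost_decided_def almost_decides_def
  proof (intro allI impI equalityI subsetI)
    fix \<B> S
    assume \<B>: "\<B> \<subseteq> \<F>" "\<B> \<approx> K" and "S \<in> orthogonal \<B>"
    then have S: "infinite S" "\<And>X. X \<in> \<B> \<Longrightarrow> finite (X \<inter> S)"
      by (auto simp: orthogonal_def almost_disjoint_def)
    have "S \<in> generated_ideal \<F>"
    proof (rule ccontr)
      assume "S \<notin> generated_ideal \<F>"
      moreover have "\<B> \<subseteq> {X \<in> \<F>. finite (X \<inter> S)}"
        using \<B>(1) S(2) by blast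
      ultimately have "\<B> \<prec> K"
        using small lesspoll_trans1 subset_imp_lepoll by blast
      with \<B>(2) show False
        by (simp add: lesspoll_def)
    qed
    then obtain \<G>' where \<G>': "\<G>' \<subseteq> \<F>" "finite \<G>'" "finite (S - \<Union>\<G>')"
      by (auto simp: generated_ideal_def)
    have "finite ((S - \<Union>\<G>') \<union> (\<Union>X\<in>\<G>' \<inter> \<B>. X \<inter> S))"
      using \<G>' S(2) by blast
    then have "finite (S - \<Union>(\<G>' - \<B>))"
      by (rule finite_subset[rotated]) blast
    then show "S \<in> {S \<in> generated_ideal (\<F> - \<B>). infinite S}"
      using S(1) \<G>'(1,2) by (auto simp: generated_ideal_def intro!: exI[of _ "\<G>' - \<B>"])
  next
    fix \<B> S
    assume \<B>: "\<B> \<subseteq> \<F>" and S: "S \<in> {S \<in> generated_ideal (\<F> - \<B>). infinite S}"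
    then obtain \<G>' where \<G>': "\<G>' \<subseteq> \<F> - \<B>" "finite \<G>'" "finite (S - \<Union>\<G>')"
      by (auto simp: generated_ideal_def)
    have "finite (X \<inter> S)" if X: "X \<in> \<B>" for X
    proof -
      have "finite (X \<inter> Z)" if "Z \<in> \<G>'" for Z
        using that X \<B> \<G>'(1) by (intro ad_family_finite_Int[OF ad]) auto
      then have "finite ((S - \<Union>\<G>') \<union> (\<Union>Z\<in>\<G>'. X \<inter> Z))"
        using \<G>'(2,3) by blast
      then show ?thesis
        by (rule finite_subset[rotated]) blast
    qed
    then show "S \<in> orthogonal \<B>"
      using S by (auto simp: orthogonal_def almost_disjoint_def)
  qed
qed

theorem theorem6p2:
  assumes MA_sigma_centered
  shows "\<exists>\<F>. mad_family \<F> \<and> infinite \<F> \<and> almost_decided continuum \<F>"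
proof -
  obtain R :: "nat set rel" where R: "wf R" "total R" and init: "\<And>a. {b. (b, a) \<in> R} \<prec> continuum"
    using continuum_well_order by blast
  obtain B :: "nat \<Rightarrow> bool list set" where B: "\<And>n. infinite (B n)"
    "\<And>m n. m \<noteq> n \<Longrightarrow> B m \<inter> B n = {}" "(\<Union>n. B n) = UNIV"
    using countable_infinite_partition by blast
  have "B m \<noteq> B n" if "m \<noteq> n" for m n
    using B(1)[of m] B(2)[OF that] by auto
  then have "inj B"
    by (auto simp: inj_on_def)
  then have infB: "infinite (range B)"
    using finite_imageD by blast
  have smallB: "range B \<prec> continuum"
    using image_lepoll nat_lesspoll_continuum lesspoll_trans1 by blast
  \<comment> \<open>The coding of \<open>T\<close> by naturals lets the elements of
    \<open>continuum\<close> index all subsets of \<open>T\<close>.\<close>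
  define Y :: "nat set \<Rightarrow> bool list set" where "Y = (\<lambda>a. {xs. to_nat xs \<in> a})"
  have Y_surj: "\<exists>a. S = Y a" for S
    by (rule exI[of _ "to_nat ` S"]) (auto simp: Y_def)
  define stage where "stage = (\<lambda>X a. range B \<union> X ` {b. (b, a) \<in> R})"
  \<comment> \<open>Positivity is tested only against the current stage, so \<open>good X a\<close>
    depends on \<open>X\<close> only below \<open>a\<close>, as well-founded choice
    requires.\<close>
  define good where "good = (\<lambda>X a Z. infinite Z \<and> (\<forall>W\<in>stage X a. finite (Z \<inter> W)) \<and>
    (\<forall>b. (b, a) \<in> R\<^sup>= \<longrightarrow> Y b \<notin> generated_ideal (stage X a) \<longrightarrow> infinite (Z \<inter> Y b)))"
  \<comment> \<open>Of two indices the later one is good over a stage containing the earlier set.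
    Stating this for any index set \<open>A\<close> covers both the stages and the final
    family.\<close>
  have ad: "ad_family (range B \<union> X ` A)" if X: "\<And>a. a \<in> A \<Longrightarrow> good X a (X a)" for X A
    unfolding ad_family_def pairwise_def almost_disjoint_def
  proof (intro conjI ballI impI)
    fix V assume "V \<in> range B \<union> X ` A"
    then show "infinite V"
      using B(1) X by (auto simp: good_def)
  next
    fix V W assume V: "V \<in> range B \<union> X ` A" and W: "W \<in> range B \<union> X ` A" and "V \<noteq> W"
    have XB: "finite (X a \<inter> B n)" if "a \<in> A" for a n
      using X[OF that] by (auto simp: good_def stage_def)
    have XX: "finite (X a \<inter> X b)" if "a \<in> A" "b \<in> A" "X a \<noteq> X b" for a b
    proof -
      have "(a, b) \<in> R \<or> (b, a) \<in> R"
        using R(2) that(3) by (metis UNIV_I total_on_def)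
      then have "finite (X a \<inter> X b) \<or> finite (X b \<inter> X a)"
        using X[OF that(1)] X[OF that(2)] unfolding good_def stage_def by blast
      then show ?thesis
        by (simp add: Int_commute)
    qed
    have BX: "finite (B n \<inter> X a)" if "a \<in> A" for a n
      using XB[OF that, of n] by (simp add: Int_commute)
    have BB: "finite (B m \<inter> B n)" if "B m \<noteq> B n" for m n
      using B(2)[of m n] that by fastforce
    show "finite (V \<inter> W)"
      using V W \<open>V \<noteq> W\<close> XB BX XX BB by blast
  qed
  have small: "stage X a \<prec> continuum" for X a
    unfolding stage_def using smallB init image_lepoll lesspoll_trans1
    by (intro Un_lesspoll_continuum) blast+
  have "\<exists>X. \<forall>a. good X a (X a)"
  proof (rule dependent_wf_choice[OF R(1)])
    fix f g :: "nat set \<Rightarrow> bool list set" and a Z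
    assume "\<And>b. (b, a) \<in> R \<Longrightarrow> f b = g b"
    then have "stage f a = stage g a"
      by (auto simp: stage_def)
    then show "good f a Z = good g a Z"
      by (simp add: good_def)
  next
    fix X a assume IH: "\<And>b. (b, a) \<in> R \<Longrightarrow> good X b (X b)"
    \<comment> \<open>Including \<open>UNIV\<close>, which is positive because the stage is an
      infinite almost disjoint family, forces the new set to be infinite.\<close>
    let ?\<Y> = "{UNIV} \<union> Y ` ({a} \<union> {b. (b, a) \<in> R}) - generated_ideal (stage X a)"
    have "ad_family (stage X a)"
      unfolding stage_def using IH by (intro ad) simp
    then have UNIV: "UNIV \<notin> generated_ideal (stage X a)"
      using infB by (intro UNIV_notin_generated_ideal) (simp_all add: stage_def)
    have "{a} \<union> {b. (b, a) \<in> R} \<prec> continuum"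
      by (intro Un_lesspoll_continuum finite_lesspoll_continuum init) simp
    then have "Y ` ({a} \<union> {b. (b, a) \<in> R}) \<prec> continuum"
      by (rule lesspoll_trans1[OF image_lepoll])
    then have "{UNIV} \<union> Y ` ({a} \<union> {b. (b, a) \<in> R}) \<prec> continuum"
      by (rule Un_lesspoll_continuum[OF finite_lesspoll_continuum, rotated]) simp
    then have "?\<Y> \<prec> continuum"
      using subset_imp_lepoll[of ?\<Y>] lesspoll_trans1 by blast
    then obtain Z where Z: "\<And>W. W \<in> stage X a \<Longrightarrow> finite (Z \<inter> W)"
        "\<And>S. S \<in> ?\<Y> \<Longrightarrow> infinite (Z \<inter> S)"
      using MA_almost_disjoint_extension[OF assms small, of ?\<Y> X a] by blast
    have "good X a Z"
      using Z(1) Z(2)[of UNIV] Z(2)[of "Y _"] UNIV by (auto simp: good_def)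
    then show "\<exists>Z. good X a Z" ..
  qed
  then obtain X where X: "\<And>a. good X a (X a)"
    by blast
  define \<F> where "\<F> = range B \<union> range X"
  have adF: "ad_family \<F>"
    unfolding \<F>_def using X by (intro ad)
  have inf: "infinite \<F>"
    using infB by (simp add: \<F>_def)
  have stage_sub: "stage X a \<subseteq> \<F>" for a
    by (auto simp: stage_def \<F>_def)
  have orth: "{Z \<in> \<F>. finite (Z \<inter> S)} \<prec> continuum" if S: "S \<notin> generated_ideal \<F>" for S
  proof -
    obtain b where b: "S = Y b"
      using Y_surj by blast
    \<comment> \<open>A set outside the final ideal is outside the ideal of every stage, so from
      index \<open>b\<close> on every new set meets it infinitely. Exceptions can only lie in
      \<open>stage X b\<close>, which is small.\<close>
    have "infinite (X a \<inter> S)" if "(b, a) \<in> R\<^sup>=" for a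
      using X[of a] that S generated_ideal_mono[OF stage_sub] unfolding good_def b by blast
    moreover have "(b, a) \<in> R\<^sup>= \<or> (a, b) \<in> R" for a
      using R(2) by (auto simp: total_on_def)
    ultimately have "{Z \<in> \<F>. finite (Z \<inter> S)} \<subseteq> stage X b"
      by (auto simp: stage_def \<F>_def)
    then show ?thesis
      using small subset_imp_lepoll lesspoll_trans1 by blast
  qed
  \<comment> \<open>A later set is infinite and almost disjoint from an earlier one, hence
    different. This gives \<open>\<F>\<close> size at least the continuum, as maximality
    needs.\<close>
  have "X a \<noteq> X b" if "(a, b) \<in> R" for a b
  proof -
    have "finite (X b \<inter> X a)" "infinite (X b)"
      using X[of b] that unfolding good_def stage_def by blast+
    then show ?thesis
      by auto
  qed
  then have "inj X"
    using R(2) unfolding inj_on_def total_on_def by metis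
  then have "continuum \<lesssim> \<F>"
    unfolding lepoll_def \<F>_def by blast
  then have "\<not> \<F> \<prec> continuum"
    using lesspoll_not_refl lesspoll_trans2 by blast
  moreover have "\<Union>\<F> = UNIV"
    using B(3) by (auto simp: \<F>_def)
  ultimately show ?thesis
    using mad_family_almost_decided_if_orthogonal_small[OF adF _ _ orth] inf by blast
qed

end
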